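(* Let $\mathcal{F}=\{n_0,\dots,n_m\}\subset\{0,1,2,\dots\}$ be a finite set, let $\boldsymbol{\alpha}=[\alpha_{n_0},\dots,\alpha_{n_m}]$ with $0<\alpha_{n_i}<\infty$ fixed, and let $p(n,\boldsymbol{\theta},\boldsymbol{\alpha})$ be the type 1 inflation-deflation stationary model with base distribution $b(n,\boldsymbol{\theta})$. Suppose that the base distribution has $\lambda$ as a main parameter (one of the components of $\boldsymbol{\theta}$) and that $\lim_{\lambda\to\infty}b(n,\boldsymbol{\theta})=0$ for all $n\in\{0,1,2,\dots\}$. Then $$\lim_{\lambda\to\infty}p(n,\boldsymbol{\theta},\boldsymbol{\alpha})=0\quad\text{for all } n\in\{0,1,2,\dots\}.$$
   Context: The base distribution $b(\cdot,\boldsymbol{\theta})$ is a probability mass function on $\{0,1,2,\dots\}$ with parameter vector $\boldsymbol{\theta}\in\mathbb{R}^l$, one of whose components is $\lambda$ (it is the stationary distribution of a birth-death process, so $b(n,\boldsymbol{\theta})>0$ for all $n$). The type 1 inflation-deflation stationary model is $$p(n,\boldsymbol{\theta},\boldsymbol{\alpha})=\frac{\Bigl(\prod_{i=0}^m\alpha_{n_i}^{\mathbf{1}_{n_i}(n)}\Bigr)b(n,\boldsymbol{\theta})}{z(\boldsymbol{\theta},\boldsymbol{\alpha})},\qquad z(\boldsymbol{\theta},\boldsymbol{\alpha})=1+\sum_{i=0}^m(\alpha_{n_i}-1)b(n_i,\boldsymbol{\theta}),$$ with $\mathbf{1}_{n_i}(n)=1$ if $n=n_i$ and $0$ otherwise.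 The limit $\lambda\to\infty$ is taken with the other components of $\boldsymbol{\theta}$ and $\boldsymbol{\alpha}$ held fixed. *)

theory Defs
  imports "HOL-Probability.Probability"
begin

text \<open>
  A base distribution is a family \<open>b\<close> of probability mass functions on the naturals, indexed by
  parameter vectors in \<open>\<real>\<^sup>l\<close>. Inflation-deflation factors are given as \<open>\<alpha> :: nat \<Rightarrow> real\<close>,
  where \<open>\<alpha> j\<close> is the factor attached to the value \<open>j \<in> F\<close>; values of \<open>\<alpha>\<close> outside \<open>F\<close> are never used.
\<close>

definition id1_norm ::
  "nat set \<Rightarrow> (real ^ 'l \<Rightarrow> nat pmf) \<Rightarrow> real ^ 'l \<Rightarrow> (nat \<Rightarrow> real) \<Rightarrow> real"
where
  "id1_norm F b \<theta> \<alpha> = 1 + (\<Sum>j\<in>F. (\<alpha> j - 1) * pmf (b \<theta>) j)"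

definition id1_model ::
  "nat set \<Rightarrow> (real ^ 'l \<Rightarrow> nat pmf) \<Rightarrow> nat \<Rightarrow> real ^ 'l \<Rightarrow> (nat \<Rightarrow> real) \<Rightarrow> real"
where
  "id1_model F b n \<theta> \<alpha> =
     (\<Prod>j\<in>F. \<alpha> j ^ indicator {j} n) * pmf (b \<theta>) n / id1_norm F b \<theta> \<alpha>"

definition with_component :: "real ^ 'l \<Rightarrow> 'l \<Rightarrow> real \<Rightarrow> real ^ 'l" where
  "with_component \<theta> k x = (\<chi> i. if i = k then x else \<theta> $ i)"

end

theory Submission
  imports Defs
begin

text \<open>The normalising constant differs from 1 by a finite sum in which every term carries a
  mass \<open>pmf (b _) j\<close> that vanishes in the limit, so it tends to 1. The numerator is a
  weight depending only on \<open>n\<close> and \<open>\<alpha>\<close>, hence constant in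
  \<open>x\<close>, times a vanishing mass. The quotient therefore tends to 0 / 1 = 0.\<close>

theorem proposition3:
  fixes F :: "nat set"
    and \<alpha> :: "nat \<Rightarrow> real"
    and b :: "real ^ 'l \<Rightarrow> nat pmf"
    and \<Theta> :: "(real ^ 'l) set"
    and \<theta> :: "real ^ 'l"
    and k :: 'l
  assumes "finite F" and "F \<noteq> {}"
    and "\<And>j. j \<in> F \<Longrightarrow> 0 < \<alpha> j"
    and "\<And>\<eta> n. \<eta> \<in> \<Theta> \<Longrightarrow> 0 < pmf (b \<eta>) n"
    and "eventually (\<lambda>x. with_component \<theta> k x \<in> \<Theta>) at_top"
    and "\<And>n. ((\<lambda>x. pmf (b (with_component \<theta> k x)) n) \<longlongrightarrow> 0) at_top"
  shows "\<forall>n. ((\<lambda>x. id1_model F b n (with_component \<theta> k x) \<alpha>) \<longlongrightarrow> 0) at_top"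
proof
  fix n
  \<comment> \<open>The limit keeps the shape of \<open>id1_norm\<close> with each mass replaced by
    0, so that the limit rules match it term by term.\<close>
  have "((\<lambda>x. id1_norm F b (with_component \<theta> k x) \<alpha>) \<longlongrightarrow> 1 + (\<Sum>j\<in>F. (\<alpha> j - 1) * 0)) at_top"
    unfolding id1_norm_def by (intro tendsto_intros assms(6))
  then have norm: "((\<lambda>x. id1_norm F b (with_component \<theta> k x) \<alpha>) \<longlongrightarrow> 1) at_top"
    by simp
  have "((\<lambda>x. id1_model F b n (with_component \<theta> k x) \<alpha>)
      \<longlongrightarrow> (\<Prod>j\<in>F. \<alpha> j ^ indicator {j} n) * 0 / 1) at_top"
    unfolding id1_model_def
    \<comment> \<open>The side condition left to \<open>simp\<close> is that the limit 1 of the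
      denominator is nonzero.\<close>
    by (rule tendsto_divide[OF tendsto_mult[OF tendsto_const assms(6)] norm]) simp
  then show "((\<lambda>x. id1_model F b n (with_component \<theta> k x) \<alpha>) \<longlongrightarrow> 0) at_top"
    by simp
qed

end
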